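(* Let $G=(V,E)$ be a graph, let $(X_v)_{v\in V}$ be sets, let $X\subseteq \prod_{v\in V}X_v$, and let $d\ge 0$ be an integer. Suppose that $X$ and $G$ are $d$-compatible. Let $F\subseteq G$ be an induced forest with no isolated vertices (i.e. an induced subgraph of $G$ that is a forest, each of whose vertices has at least one neighbor in $F$). Let $L\subseteq F$ be a set of vertices obtained by choosing from each connected component of $F$ all leaves except one. Then $$x_{L\cup (G\setminus F)} \Rightarrow^{d^{|F\setminus L|}} x_{F\setminus L},$$ and in particular $$\dim_{\mathrm c}(X)\le |G|-|F|+|L|.$$ If $X$ and $G$ are strongly $d$-compatible, the same conclusions hold without the hypothesis that $F$ has no isolated vertices.
   Context: A graph $G=(V,E)$ is a pair of finite sets with $V\neq\emptyset$ and $E$ a set of $2$-element subsets of $V$; $|G|=|V|$, and $N(v)$ is the set of neighbors of $v$ (so $v\notin N(v)$). Graphs are identified with their vertex sets in expressions such as $v\in G$, $|F|$, $G\setminus F$, $F\setminus L$. A leaf of a forest is a vertex of degree $1$; an isolated vertex (degree $0$) contributes no element to $L$. Finite determinacy: for $A,B\subseteq V$ and an integer $n\ge 0$, write $x_A\Rightarrow^n x_B$ (with respect to $X\subseteq\prod_{v\in V}X_v$) if for every $(\overline x_a)_{a\in A}\in\prod_{a\in A}X_a$ there are at most $n$ elements $(\overline x_b)_{b\in B}\in\prod_{b\in B}X_b$ such that $(\overline x_v)_{v\in V}\in X$ for some $(\overline x_u)_{u\in V\setminus(A\cup B)}$; equivalently, for every $c\in\prod_{a\in A}X_a$ the set $\pi_B(\pi_A^{-1}(c)\cap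 X)$ has at most $n$ elements, where $\pi_A,\pi_B$ are the coordinate projections. Write $x_A\Rightarrow x_B$ if $x_A\Rightarrow^n x_B$ for some $n\ge 0$. Compatibility: $X$ and $G$ are $d$-compatible if for every $v\in V$ and $w\in N(v)$ we have $x_{(N(v)\setminus\{w\})\cup\{v\}}\Rightarrow^d x_w$. They are strongly $d$-compatible if moreover $x_{N(v)}\Rightarrow^d x_v$ for every $v\in V$. The combinatorial dimension $\dim_{\mathrm c}(X)$ is the minimum cardinality of a subset $A\subseteq V$ such that $x_A\Rightarrow x_V$. *)

theory Defs
  imports Main "HOL-Library.FuncSet"
begin

definition simple_graph :: "'v set \<Rightarrow> 'v set set \<Rightarrow> bool" where
  "simple_graph V E \<longleftrightarrow> finite V \<and> V \<noteq> {} \<and> (\<forall>e\<in>E. e \<subseteq> V \<and> card e = 2)"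

definition nbrs :: "'v set set \<Rightarrow> 'v \<Rightarrow> 'v set" where
  "nbrs E v = {w. {v, w} \<in> E}"

definition induced_edges :: "'v set set \<Rightarrow> 'v set \<Rightarrow> 'v set set" where
  "induced_edges E F = {e \<in> E. e \<subseteq> F}"

text \<open>A cycle is listed without repeating its initial vertex; the length bound excludes
  the back-and-forth walk along a single edge.\<close>

definition is_cycle :: "'v set set \<Rightarrow> 'v list \<Rightarrow> bool" where
  "is_cycle E p \<longleftrightarrow> 3 \<le> length p \<and> distinct p \<and>
     (\<forall>i<length p. {p ! i, p ! (Suc i mod length p)} \<in> E)"

definition forest :: "'v set \<Rightarrow> 'v set set \<Rightarrow> bool" where
  "forest V E \<longleftrightarrow> simple_graph V E \<and> (\<nexists>p. is_cycle E p)"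

definition induced_forest :: "'v set \<Rightarrow> 'v set set \<Rightarrow> 'v set \<Rightarrow> bool" where
  "induced_forest V E F \<longleftrightarrow> F \<subseteq> V \<and> forest F (induced_edges E F)"

definition no_isolated_vertices :: "'v set \<Rightarrow> 'v set set \<Rightarrow> bool" where
  "no_isolated_vertices V E \<longleftrightarrow> (\<forall>v\<in>V. nbrs E v \<noteq> {})"

definition leaves :: "'v set \<Rightarrow> 'v set set \<Rightarrow> 'v set" where
  "leaves V E = {v \<in> V. card (nbrs E v) = 1}"

definition components :: "'v set \<Rightarrow> 'v set set \<Rightarrow> 'v set set" where
  "components V E = (\<lambda>v. {(u, w). {u, w} \<in> E}\<^sup>* `` {v}) ` V"

text \<open>A component of a finite forest has no leaf exactly when it is a single isolated
  vertex; such a component contributes nothing to \<^term>\<open>L\<close>.\<close>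

definition all_leaves_but_one :: "'v set \<Rightarrow> 'v set set \<Rightarrow> 'v set \<Rightarrow> bool" where
  "all_leaves_but_one V E L \<longleftrightarrow> L \<subseteq> V \<and>
     (\<forall>C\<in>components V E.
        if leaves V E \<inter> C = {} then L \<inter> C = {}
        else \<exists>l \<in> leaves V E \<inter> C. L \<inter> C = (leaves V E \<inter> C) - {l})"

text \<open>\<open>determines Y X A n B\<close> renders $x_A \Rightarrow^n x_B$ with respect to
  $X \subseteq \prod_v Y_v$.  The coordinate projections are restrictions of extensional
  functions.  Finiteness is stated separately because \<^const>\<open>card\<close> is 0 on infinite sets.\<close>

definition determines ::
  "('v \<Rightarrow> 'a set) \<Rightarrow> ('v \<Rightarrow> 'a) set \<Rightarrow> 'v set \<Rightarrow> nat \<Rightarrow> 'v set \<Rightarrow> bool" where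
  "determines Y X A n B \<longleftrightarrow>
     (\<forall>c \<in> PiE A Y.
        let S = (\<lambda>x. restrict x B) ` {x \<in> X. restrict x A = c} in finite S \<and> card S \<le> n)"

definition finitely_determines ::
  "('v \<Rightarrow> 'a set) \<Rightarrow> ('v \<Rightarrow> 'a) set \<Rightarrow> 'v set \<Rightarrow> 'v set \<Rightarrow> bool" where
  "finitely_determines Y X A B \<longleftrightarrow> (\<exists>n. determines Y X A n B)"

definition compatible ::
  "'v set \<Rightarrow> 'v set set \<Rightarrow> ('v \<Rightarrow> 'a set) \<Rightarrow> ('v \<Rightarrow> 'a) set \<Rightarrow> nat \<Rightarrow> bool" where
  "compatible V E Y X d \<longleftrightarrow>
     (\<forall>v\<in>V. \<forall>w\<in>nbrs E v. determines Y X ((nbrs E v - {w}) \<union> {v}) d {w})"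

definition strongly_compatible ::
  "'v set \<Rightarrow> 'v set set \<Rightarrow> ('v \<Rightarrow> 'a set) \<Rightarrow> ('v \<Rightarrow> 'a) set \<Rightarrow> nat \<Rightarrow> bool" where
  "strongly_compatible V E Y X d \<longleftrightarrow>
     compatible V E Y X d \<and> (\<forall>v\<in>V. determines Y X (nbrs E v) d {v})"

text \<open>For finite \<^term>\<open>V\<close> and $X \subseteq \prod_{v \in V} Y_v$ the minimum exists, since
  \<^term>\<open>V\<close> finitely determines itself.\<close>

definition comb_dim :: "'v set \<Rightarrow> ('v \<Rightarrow> 'a set) \<Rightarrow> ('v \<Rightarrow> 'a) set \<Rightarrow> nat" where
  "comb_dim V Y X = Min (card ` {A. A \<subseteq> V \<and> finitely_determines Y X A V})"

end

theory Submission
  imports Defs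
begin

text \<open>
  If \<open>F\<close> has no isolated vertices, \<^term>\<open>L \<union> (V - F)\<close> is a zero forcing set of the
  graph.  Say that a vertex \<open>v\<close> of a set \<open>K\<close> of already known vertices forces its neighbour \<open>w\<close> when \<open>w\<close> is the only neighbour of
  \<open>v\<close> outside \<open>K\<close>.  Compatibility turns each such step into the determination of \<open>x\<^sub>w\<close> by \<open>x\<^sub>K\<close>
  up to \<open>d\<close> possibilities, and the bounds multiply along a chain of steps
  (\<open>determines_chain\<close>).  As every vertex of \<^term>\<open>F - L\<close> is added exactly once, the total is
  \<open>d\<close> to the power \<^term>\<open>card (F - L)\<close>.

  What remains is that the process never stops before reaching \<^term>\<open>V\<close>
  (\<open>forest_forcing_step\<close>).  Suppose it stops with a nonempty set \<open>U\<close> of unknown vertices; these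
  lie in \<^term>\<open>F - L\<close>.  Then a vertex of \<open>F\<close> outside \<open>U\<close> with one neighbour in \<open>U\<close> has a second
  one.  Hence a path in \<open>F\<close> with both ends in \<open>U\<close> can be prolonged beyond an end of degree at
  least \<open>2\<close>: move to a new neighbour, and, if this one is known, on to another unknown vertex.
  Acyclicity keeps the new vertices off the path.  A longest such path therefore ends in two
  leaves of the same component, both outside \<^term>\<open>L\<close>, although \<^term>\<open>L\<close> misses only one leaf of
  each component; or it is a single isolated vertex, which is either excluded or, under strong
  compatibility, determined by its neighbours, all of which lie outside \<open>F\<close>.
\<close>

section \<open>Finite determinacy\<close>

lemma determinesD:
  assumes "determines Y X A n B" and "c \<in> PiE A Y"
  shows "finite ((\<lambda>x. restrict x B) ` {x \<in> X. restrict x A = c})"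
    and "card ((\<lambda>x. restrict x B) ` {x \<in> X. restrict x A = c}) \<le> n"
  using assms by (auto simp: determines_def Let_def)

lemma determines_mono_source:
  assumes "determines Y X A n B" and "A \<subseteq> A'"
  shows "determines Y X A' n B"
  unfolding determines_def Let_def
proof
  fix c assume c: "c \<in> PiE A' Y"
  let ?S = "(\<lambda>x. restrict x B) ` {x \<in> X. restrict x A' = c}"
  let ?T = "(\<lambda>x. restrict x B) ` {x \<in> X. restrict x A = restrict c A}"
  have "restrict c A \<in> PiE A Y" using c assms(2) by auto
  note T = determinesD[OF assms(1) this]
  have "restrict x A = restrict c A" if "restrict x A' = c" for x
    using that assms(2) by (metis Int_absorb1 restrict_restrict)
  then have "?S \<subseteq> ?T" by auto
  with T show "finite ?S \<and> card ?S \<le> n"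
    by (meson card_mono finite_subset le_trans)
qed

lemma determines_mono_target:
  assumes "determines Y X A n B" and "B' \<subseteq> B"
  shows "determines Y X A n B'"
  unfolding determines_def Let_def
proof
  fix c assume c: "c \<in> PiE A Y"
  let ?fib = "{x \<in> X. restrict x A = c}"
  note S = determinesD[OF assms(1) c]
  have eq: "(\<lambda>x. restrict x B') ` ?fib = (\<lambda>t. restrict t B') ` (\<lambda>x. restrict x B) ` ?fib"
    using assms(2) by (simp add: image_image Int_absorb1)
  show "finite ((\<lambda>x. restrict x B') ` ?fib) \<and> card ((\<lambda>x. restrict x B') ` ?fib) \<le> n"
    unfolding eq using finite_imageI[OF S(1)] le_trans[OF card_image_le[OF S(1)] S(2)] ..
qed

text \<open>The fibre over a point of the \<^term>\<open>A\<close>-coordinates splits into at most \<^term>\<open>m\<close> fibres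
  over points of the \<^term>\<open>A \<union> B\<close>-coordinates.\<close>

lemma determines_trans:
  assumes X: "X \<subseteq> PiE V Y" and AB: "A \<union> B \<subseteq> V"
    and m: "determines Y X A m B" and n: "determines Y X (A \<union> B) n C"
  shows "determines Y X A (m * n) C"
  unfolding determines_def Let_def
proof
  fix c assume c: "c \<in> PiE A Y"
  define fib where "fib = {x \<in> X. restrict x A = c}"
  define T where "T = (\<lambda>x. restrict x (A \<union> B)) ` fib"
  define S where "S t = (\<lambda>x. restrict x C) ` {x \<in> X. restrict x (A \<union> B) = t}" for t
  have "(\<lambda>t. restrict t B) ` T = (\<lambda>x. restrict x B) ` fib"
    unfolding T_def image_image by (simp add: Int_absorb1)
  moreover have "inj_on (\<lambda>t. restrict t B) T"
  proof (rule inj_onI)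
    fix s t assume "s \<in> T" "t \<in> T" and eq: "restrict s B = restrict t B"
    then obtain x y where x: "s = restrict x (A \<union> B)" "restrict x A = c"
      and y: "t = restrict y (A \<union> B)" "restrict y A = c"
      by (auto simp: T_def fib_def)
    show "s = t"
    proof
      fix v
      consider "v \<in> A" | "v \<in> B" | "v \<notin> A \<union> B" by blast
      then show "s v = t v"
      proof cases
        case 1 then show ?thesis using x y by (metis UnI1 restrict_apply')
      next
        case 2 then show ?thesis using eq by (metis restrict_apply')
      next
        case 3 then show ?thesis using x y by simp
      qed
    qed
  qed
  ultimately have T: "finite T" "card T \<le> m"
    using determinesD[OF m c] by (metis fib_def finite_image_iff, metis card_image fib_def)
  have S: "finite (S t) \<and> card (S t) \<le> n" if "t \<in> T" for t
  proof -
    from that obtain x where x: "x \<in> X" "t = restrict x (A \<union> B)"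
      by (auto simp: T_def fib_def)
    then have "x \<in> PiE V Y" using X by blast
    then have "t \<in> PiE (A \<union> B) Y"
      unfolding x(2) restrict_PiE_iff using AB by (meson PiE_mem subsetD)
    then show ?thesis using determinesD[OF n] by (simp add: S_def)
  qed
  have sub: "(\<lambda>x. restrict x C) ` fib \<subseteq> (\<Union>t\<in>T. S t)"
    by (auto simp: T_def S_def fib_def)
  have fin: "finite (\<Union>t\<in>T. S t)" using T S by blast
  have "card ((\<lambda>x. restrict x C) ` fib) \<le> card (\<Union>t\<in>T. S t)"
    by (rule card_mono[OF fin sub])
  also have "\<dots> \<le> (\<Sum>t\<in>T. card (S t))" by (rule card_UN_le[OF T(1)])
  also have "\<dots> \<le> card T * n" using S sum_bounded_above[of T "\<lambda>t. card (S t)" n] by simp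
  also have "\<dots> \<le> m * n" using T(2) by simp
  finally show "finite ((\<lambda>x. restrict x C) ` {x \<in> X. restrict x A = c}) \<and>
      card ((\<lambda>x. restrict x C) ` {x \<in> X. restrict x A = c}) \<le> m * n"
    using finite_subset[OF sub fin] by (simp add: fib_def)
qed

lemma determines_self: "determines Y X A 1 A"
  unfolding determines_def Let_def
proof
  fix c :: "'a \<Rightarrow> 'b"
  have "(\<lambda>x. restrict x A) ` {x \<in> X. restrict x A = c} \<subseteq> {c}" by auto
  then show "finite ((\<lambda>x. restrict x A) ` {x \<in> X. restrict x A = c}) \<and>
      card ((\<lambda>x. restrict x A) ` {x \<in> X. restrict x A = c}) \<le> 1"
    using card_mono[of "{c}"] finite_subset[of _ "{c}"] by fastforce
qed

text \<open>The step hypothesis is required of all intermediate sets, so the vertices can be added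
  in a greedy order that need not be described in advance.\<close>

lemma determines_chain:
  assumes "finite V" and X: "X \<subseteq> PiE V Y" and "A \<subseteq> V"
    and step: "\<And>K. A \<subseteq> K \<Longrightarrow> K \<subset> V \<Longrightarrow> \<exists>w\<in>V - K. determines Y X K d {w}"
  shows "determines Y X A (d ^ card (V - A)) V"
  using assms(3,4)
proof (induction "card (V - A)" arbitrary: A)
  case 0
  then have "A = V" using \<open>finite V\<close> by auto
  then show ?case using determines_self[of Y X V] by simp
next
  case (Suc k)
  then have "A \<subset> V" by (metis Diff_cancel card.empty nat.distinct(1) psubsetI)
  then obtain w where w: "w \<in> V - A" "determines Y X A d {w}" using Suc.prems(2) by blast
  have "V - insert w A = (V - A) - {w}" by blast
  then have k: "k = card (V - insert w A)"
    using Suc.hyps(2) w(1) \<open>finite V\<close> by simp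
  have "determines Y X (insert w A) (d ^ card (V - insert w A)) V"
  proof (rule Suc.hyps(1)[OF k])
    show "insert w A \<subseteq> V" using w(1) Suc.prems(1) by blast
    show "\<exists>w'\<in>V - K. determines Y X K d {w'}" if "insert w A \<subseteq> K" "K \<subset> V" for K
      using Suc.prems(2) that by blast
  qed
  then have "determines Y X (A \<union> {w}) (d ^ k) V" using k by simp
  then have "determines Y X A (d * d ^ k) V"
    using w Suc.prems(1) by (intro determines_trans[OF X _ w(2)]) auto
  then show ?case using Suc.hyps(2) by (metis power_Suc)
qed

lemma comb_dim_le:
  assumes "finite V" and "A \<subseteq> V" and "determines Y X A n V"
  shows "comb_dim V Y X \<le> card A"
  unfolding comb_dim_def
  using assms by (intro Min_le) (auto simp: finitely_determines_def)

section \<open>Paths in forests\<close>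

definition path :: "'v set set \<Rightarrow> 'v list \<Rightarrow> bool" where
  "path E p \<longleftrightarrow> distinct p \<and> successively (\<lambda>a b. {a, b} \<in> E) p"

lemma path_rev: "path E (rev p) \<longleftrightarrow> path E p"
  by (simp add: path_def successively_rev insert_commute)

lemma path_Cons:
  "path E (a # p) \<longleftrightarrow> a \<notin> set p \<and> (p = [] \<or> {a, hd p} \<in> E) \<and> path E p"
  by (cases p) (auto simp: path_def)

lemma path_component:
  assumes "path E (a # p)" shows "(a, last (a # p)) \<in> {(u, w). {u, w} \<in> E}\<^sup>*"
  using assms
proof (induction p arbitrary: a)
  case Nil
  then show ?case by simp
next
  case (Cons b p)
  then have "{a, b} \<in> E" and "path E (b # p)" by (auto simp: path_Cons)
  with Cons.IH[of b] show ?case by (simp add: converse_rtrancl_into_rtrancl)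
qed

lemma closed_path_is_cycle:
  assumes "path E p" and "3 \<le> length p" and "{last p, hd p} \<in> E"
  shows "is_cycle E p"
  unfolding is_cycle_def
proof (intro conjI allI impI)
  show "3 \<le> length p" "distinct p" using assms by (auto simp: path_def)
next
  fix i assume i: "i < length p"
  show "{p ! i, p ! (Suc i mod length p)} \<in> E"
  proof (cases "Suc i < length p")
    case True
    then show ?thesis using assms(1) by (simp add: path_def successively_conv_nth)
  next
    case False
    then have "Suc i = length p" using i by simp
    then have "p ! i = last p" "p ! (Suc i mod length p) = hd p"
      using i by (metis diff_Suc_1 last_conv_nth length_0_conv not_less_zero,
        metis hd_conv_nth length_0_conv mod_self not_less_zero)
    then show ?thesis using assms(3) by simp
  qed
qed

text \<open>A chord from the first vertex would close up an initial segment of the path to a cycle.\<close>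

lemma acyclic_path_no_chord:
  assumes acyclic: "\<nexists>c. is_cycle E c" and p: "path E (a # p)"
    and z: "z \<in> set p" "{a, z} \<in> E"
  shows "z = hd p"
proof (rule ccontr)
  assume "z \<noteq> hd p"
  obtain q1 q2 where q: "p = q1 @ z # q2" using z(1) by (meson split_list)
  with \<open>z \<noteq> hd p\<close> have "q1 \<noteq> []" by auto
  have "path E ((a # q1 @ [z]) @ q2)" using p q by simp
  then have "path E (a # q1 @ [z])"
    unfolding path_def successively_append_iff distinct_append by blast
  then have "is_cycle E (a # q1 @ [z])"
    using \<open>q1 \<noteq> []\<close> z(2) by (intro closed_path_is_cycle) (auto simp: Suc_le_eq insert_commute)
  with acyclic show False by blast
qed

section \<open>The forcing step\<close>

text \<open>If every known neighbour of an unknown vertex has a second unknown neighbour, a path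
  between unknown vertices stops growing at its head only when the head has no further
  neighbour at all.  The \<open>take\<close> covers the one-vertex path, whose head has no neighbour on the
  path.\<close>

lemma head_of_longest_path:
  assumes acyclic: "\<nexists>c. is_cycle E c" and no_loop: "\<And>x. {x, x} \<notin> E"
    and p: "path E (a # p)" and U: "a \<in> U" "last (a # p) \<in> U"
    and longest: "\<And>p'. path E p' \<Longrightarrow> p' \<noteq> [] \<Longrightarrow> hd p' \<in> U \<Longrightarrow> last p' \<in> U
      \<Longrightarrow> length p' \<le> length (a # p)"
    and no_force: "\<And>v. v \<notin> U \<Longrightarrow> nbrs E v \<inter> U \<noteq> {a}"
  shows "nbrs E a = set (take 1 p)"
proof
  show "set (take 1 p) \<subseteq> nbrs E a"
    using p by (cases p) (auto simp: path_Cons nbrs_def)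
  show "nbrs E a \<subseteq> set (take 1 p)"
  proof (rule subsetI, rule ccontr)
    fix x assume "x \<in> nbrs E a" and x: "x \<notin> set (take 1 p)"
    then have ax: "{a, x} \<in> E" by (simp add: nbrs_def)
    then have "x \<noteq> a" using no_loop by auto
    have "x \<notin> set p"
      using acyclic_path_no_chord[OF acyclic p _ ax] x by (cases p) auto
    with \<open>x \<noteq> a\<close> ax p have xp: "path E (x # a # p)"
      by (subst path_Cons) (simp add: insert_commute)
    show False
    proof (cases "x \<in> U")
      case True
      then show False using longest[OF xp] U by simp
    next
      case False
      have "a \<in> nbrs E x \<inter> U" using ax U by (simp add: nbrs_def insert_commute)
      with no_force[OF False] obtain y where y: "y \<in> U" "{x, y} \<in> E" "y \<noteq> a"
        by (auto simp: nbrs_def)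
      have "y \<notin> set (a # p)" using acyclic_path_no_chord[OF acyclic xp _ y(2)] y(3) by auto
      moreover have "y \<noteq> x" using y(2) no_loop by auto
      ultimately have "path E (y # x # a # p)"
        using xp y(2) by (subst path_Cons) (simp add: insert_commute)
      then show False using longest[of "y # x # a # p"] U y(1) by simp
    qed
  qed
qed

lemma two_leaves_outside:
  assumes "all_leaves_but_one F E L" and "u \<in> leaves F E - L" and "v \<in> leaves F E - L"
    and "(u, v) \<in> {(u, w). {u, w} \<in> E}\<^sup>*"
  shows "u = v"
proof -
  define C where "C = {(u, w). {u, w} \<in> E}\<^sup>* `` {u}"
  have uv: "u \<in> leaves F E \<inter> C" "v \<in> leaves F E \<inter> C" using assms(2-4) by (auto simp: C_def)
  moreover have "C \<in> components F E" using uv by (auto simp: components_def C_def leaves_def)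
  moreover have "leaves F E \<inter> C \<noteq> {}" using uv by blast
  ultimately obtain l where "L \<inter> C = (leaves F E \<inter> C) - {l}"
    using assms(1) unfolding all_leaves_but_one_def by (metis (no_types, lifting))
  then show ?thesis using uv assms(2,3) by blast
qed

text \<open>The step may be found inside the forest alone: as \<open>U\<close> lies in \<open>F\<close>, a vertex of \<open>F\<close> has the
  same neighbours in \<open>U\<close> within \<open>F\<close> as within a graph of which \<open>F\<close> is an induced subgraph.  The proof plays the two ends of a
  longest path with both ends in \<open>U\<close> against the fact that \<open>L\<close> misses only one leaf of a component.\<close>

lemma forest_forcing_step:
  assumes forest: "forest F E" and L: "all_leaves_but_one F E L"
    and U: "U \<subseteq> F - L" "U \<noteq> {}"
  shows "(\<exists>u\<in>U. nbrs E u = {}) \<or> (\<exists>v\<in>F - U. \<exists>w\<in>U. nbrs E v \<inter> U = {w})"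
proof (rule ccontr)
  assume stuck: "\<not> ?thesis"
  have acyclic: "\<nexists>c. is_cycle E c" and "finite F"
    and edge: "\<And>e. e \<in> E \<Longrightarrow> e \<subseteq> F \<and> card e = 2"
    using forest by (auto simp: forest_def simple_graph_def)
  have no_loop: "{x, x} \<notin> E" for x using edge[of "{x, x}"] by auto
  have no_force: "nbrs E v \<inter> U \<noteq> {a}" if "v \<notin> U" for v a
  proof
    assume *: "nbrs E v \<inter> U = {a}"
    then have "{v, a} \<in> E" by (auto simp: nbrs_def)
    then have "v \<in> F" using edge by blast
    with * that stuck show False by blast
  qed
  define P where "P p \<longleftrightarrow> path E p \<and> p \<noteq> [] \<and> hd p \<in> U \<and> last p \<in> U" for p
  have "set p \<subseteq> F" if "path E p" "p \<noteq> []" "last p \<in> U" for p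
    using that
  proof (induction p)
    case (Cons a p)
    then show ?case using U edge[of "{a, hd p}"] by (cases "p = []") (auto simp: path_Cons)
  qed simp
  then have bound: "\<forall>p. P p \<longrightarrow> length p < Suc (card F)"
    using \<open>finite F\<close> unfolding P_def path_def
    by (metis card_mono distinct_card le_imp_less_Suc)
  obtain u where "u \<in> U" using U(2) by blast
  then have "P [u]" by (simp add: P_def path_def)
  from ex_has_greatest_nat[of P, OF this bound]
  obtain p where p: "P p" and longest: "\<And>q. P q \<Longrightarrow> length q \<le> length p" by blast
  from p obtain a q where aq: "p = a # q" by (cases p) (auto simp: P_def)
  from p obtain b r where br: "rev p = b # r" by (cases "rev p") (auto simp: P_def)
  have len: "length r = length q" using aq br by (metis length_Cons length_rev nat.inject)
  have nbr_a: "nbrs E a = set (take 1 q)"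
    using p longest unfolding P_def aq
    by (intro head_of_longest_path[OF acyclic no_loop _ _ _ _ no_force]) auto
  \<comment> \<open>The other end is the head of the reversed path, which is again a longest one.\<close>
  have "P (rev p)" using p by (simp add: P_def path_rev hd_rev last_rev)
  moreover have "length p = length (b # r)" using aq len by simp
  ultimately have nbr_b: "nbrs E b = set (take 1 r)"
    using longest unfolding P_def br
    by (intro head_of_longest_path[OF acyclic no_loop _ _ _ _ no_force]) auto
  have a: "a \<in> U" using p aq by (simp add: P_def)
  have "b = last p" using br by (metis hd_rev list.sel(1))
  with p have b: "b \<in> U" "b = last p" by (simp_all add: P_def)
  have "q \<noteq> []" using nbr_a a stuck by auto
  then have "r \<noteq> []" using len by auto
  have "card (nbrs E a) = 1" using nbr_a \<open>q \<noteq> []\<close> by (cases q) auto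
  moreover have "card (nbrs E b) = 1" using nbr_b \<open>r \<noteq> []\<close> by (cases r) auto
  ultimately have "a \<in> leaves F E - L" "b \<in> leaves F E - L" using a b U by (auto simp: leaves_def)
  moreover have "(a, b) \<in> {(u, w). {u, w} \<in> E}\<^sup>*"
    using p path_component[of E a q] b(2) aq by (simp add: P_def)
  ultimately have "a = b" by (rule two_leaves_outside[OF L])
  then show False using p \<open>q \<noteq> []\<close> b(2) aq by (auto simp: P_def path_def)
qed

section \<open>Determinacy on a graph with an induced forest\<close>

lemma nbrs_induced_edges:
  "v \<in> F \<Longrightarrow> nbrs (induced_edges E F) v = nbrs E v \<inter> F"
  by (auto simp: nbrs_def induced_edges_def)

text \<open>The premise \<open>isolated\<close> is the common denominator of the two variants of the theorem: it
  holds vacuously without isolated vertices, and is part of strong compatibility.\<close>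

lemma forest_determinacy:
  assumes G: "simple_graph V E" and X: "X \<subseteq> PiE V Y"
    and F: "induced_forest V E F" and L: "all_leaves_but_one F (induced_edges E F) L"
    and compat: "compatible V E Y X d"
    and isolated: "\<And>v. v \<in> F \<Longrightarrow> nbrs (induced_edges E F) v = {}
      \<Longrightarrow> determines Y X (nbrs E v) d {v}"
  shows "determines Y X (L \<union> (V - F)) (d ^ card (F - L)) (F - L)"
    and "int (comb_dim V Y X) \<le> int (card V) - int (card F) + int (card L)"
proof -
  let ?A = "L \<union> (V - F)"
  have FV: "F \<subseteq> V" and forest: "forest F (induced_edges E F)" and LF: "L \<subseteq> F"
    using F L by (auto simp: induced_forest_def all_leaves_but_one_def)
  have "finite V" using G by (simp add: simple_graph_def)
  have nbrs_V: "nbrs E v \<subseteq> V" for v using G by (auto simp: nbrs_def simple_graph_def)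
  have step: "\<exists>w\<in>V - K. determines Y X K d {w}" if K: "?A \<subseteq> K" "K \<subset> V" for K
  proof -
    have U: "V - K \<subseteq> F - L" "V - K \<noteq> {}" using K by auto
    from forest_forcing_step[OF forest L U] consider
        (isolated) u where "u \<in> V - K" "nbrs (induced_edges E F) u = {}"
      | (force) v w where "v \<in> F" "v \<in> K" "w \<in> V - K"
          "nbrs (induced_edges E F) v \<inter> (V - K) = {w}"
      using FV by blast
    then show ?thesis
    proof cases
      case isolated
      then have "u \<in> F" using U by blast
      then have "nbrs E u \<subseteq> K" using isolated(2) nbrs_V[of u] K by (auto simp: nbrs_induced_edges)
      with assms(6)[OF \<open>u \<in> F\<close> isolated(2)] have "determines Y X K d {u}"
        by (rule determines_mono_source)
      then show ?thesis using isolated(1) ..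
    next
      case force
      \<comment> \<open>Neighbours of \<open>v\<close> outside \<open>F\<close> are known, so \<open>w\<close> is its only unknown neighbour in the
        whole graph.\<close>
      then have w: "nbrs E v \<inter> (V - K) = {w}" using U by (auto simp: nbrs_induced_edges)
      then have "(nbrs E v - {w}) \<union> {v} \<subseteq> K" using nbrs_V[of v] force by blast
      moreover have "determines Y X ((nbrs E v - {w}) \<union> {v}) d {w}"
        using compat w force FV by (auto simp: compatible_def)
      ultimately have "determines Y X K d {w}" by (rule determines_mono_source[rotated])
      then show ?thesis using force(3) ..
    qed
  qed
  have "V - ?A = F - L" using FV LF by blast
  have "?A \<subseteq> V" using FV LF by blast
  from determines_chain[OF \<open>finite V\<close> X this step]
  have det: "determines Y X ?A (d ^ card (F - L)) V" unfolding \<open>V - ?A = F - L\<close> .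
  then show "determines Y X ?A (d ^ card (F - L)) (F - L)"
    by (rule determines_mono_target) (use FV in blast)
  have "finite F" using \<open>finite V\<close> FV by (rule rev_finite_subset)
  then have "finite L" using LF by (rule rev_finite_subset)
  have "comb_dim V Y X \<le> card ?A" by (rule comb_dim_le[OF \<open>finite V\<close> \<open>?A \<subseteq> V\<close> det])
  also have "card ?A = card L + (card V - card F)"
    using \<open>finite V\<close> \<open>finite F\<close> \<open>finite L\<close> FV LF
    by (subst card_Un_disjoint) (auto simp: card_Diff_subset)
  finally show "int (comb_dim V Y X) \<le> int (card V) - int (card F) + int (card L)"
    using card_mono[OF \<open>finite V\<close> FV] by linarith
qed

theorem theorem17:
  fixes V :: "'v set" and E :: "'v set set"
    and Y :: "'v \<Rightarrow> 'a set" and X :: "('v \<Rightarrow> 'a) set"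
    and d :: nat and F L :: "'v set"
  assumes "simple_graph V E"
    and "X \<subseteq> PiE V Y"
    and "induced_forest V E F"
    and "all_leaves_but_one F (induced_edges E F) L"
  shows "(compatible V E Y X d \<and> no_isolated_vertices F (induced_edges E F) \<longrightarrow>
            determines Y X (L \<union> (V - F)) (d ^ card (F - L)) (F - L) \<and>
            int (comb_dim V Y X) \<le> int (card V) - int (card F) + int (card L)) \<and>
         (strongly_compatible V E Y X d \<longrightarrow>
            determines Y X (L \<union> (V - F)) (d ^ card (F - L)) (F - L) \<and>
            int (comb_dim V Y X) \<le> int (card V) - int (card F) + int (card L))"
proof (intro conjI impI; (elim conjE)?)
  assume c: "compatible V E Y X d" and "no_isolated_vertices F (induced_edges E F)"
  then have "determines Y X (nbrs E v) d {v}"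
    if "v \<in> F" "nbrs (induced_edges E F) v = {}" for v
    using that by (auto simp: no_isolated_vertices_def)
  note forest_determinacy[OF assms c this]
  then show "determines Y X (L \<union> (V - F)) (d ^ card (F - L)) (F - L)"
    and "int (comb_dim V Y X) \<le> int (card V) - int (card F) + int (card L)" by auto
next
  assume s: "strongly_compatible V E Y X d"
  have c: "compatible V E Y X d" using s by (simp add: strongly_compatible_def)
  have "determines Y X (nbrs E v) d {v}" if "v \<in> F" for v
    using s that assms(3) by (auto simp: strongly_compatible_def induced_forest_def)
  note forest_determinacy[OF assms c this]
  then show "determines Y X (L \<union> (V - F)) (d ^ card (F - L)) (F - L)"
    and "int (comb_dim V Y X) \<le> int (card V) - int (card F) + int (card L)" by auto
qed

end
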